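(* Let $K$ be a field (not necessarily commutative), let $R$ be a ring with $1$, and let $U$ be a $(K,R)$-bimodule. Let $\mathcal{G}$ be the set of all subspaces of the left $K$-vector space $U\times U$ that are isomorphic to one of their complements in $U\times U$. Then the mapping $$\Phi:\mathbb{P}(R)\to\mathcal{G}:\ R(a,b)\mapsto U^{(\rho_a,\rho_b)}=\{(u\cdot a,\,u\cdot b)\mid u\in U\}\qquad ((a,b)\text{ admissible})$$ maps distant points of $\mathbb{P}(R)$ to complementary subspaces of $U\times U$. The bimodule $U$ is faithful if, and only if, $\Phi$ is injective.
   Context: All rings have a $1$ (the case $1=0$ is not excluded). "Field" means a not necessarily commutative field (division ring). Projective line: $\mathrm{GL}_2(R)$ is the group of invertible $2\times2$ matrices over $R$, acting on the free left $R$-module $R^2$ (row vectors) by right multiplication. A pair $(a,b)\in R^2$ is admissible if there are $c,d\in R$ with $\begin{pmatrix}a&b\\c&d\end{pmatrix}\in\mathrm{GL}_2(R)$. The projective line over $R$ is the set of submodules $\mathbb{P}(R)=\{R(a,b)\subset R^2\mid (a,b)\text{ admissible}\}$, i.e. the orbit of $R(1,0)$ under $\mathrm{GL}_2(R)$. Two points $p,q\in\mathbb{P}(R)$ are distant if there is $\gamma\in\mathrm{GL}_2(R)$ mapping $R(1,0)$ to $p$ and $R(0,1)$ to $q$. Bimodules: a $(K,R)$-bimodule is a left $K$-vector space $U$ that is also a unitary right $R$-module with $k(u\cdot a)=(ku)\cdot a$ for all $k\in K$, $u\in U$, $a\in R$. For $a\in R$ let $\rho_a\in\mathrm{End}_K(U)$,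 $\rho_a:u\mapsto u\cdot a$. Endomorphisms act on the right (so $u^{\alpha\beta}=(u^\alpha)^\beta$), and $\phi:R\to\mathrm{End}_K(U)$, $a\mapsto\rho_a$, is a unital ring homomorphism. $U$ is faithful if $\phi$ is injective. Points of $\mathbb{P}(R)$ are always represented by admissible pairs; the image $R(a,b)^\Phi$ does not depend on the choice of admissible representative. The projective space $\mathbb{P}(K,U\times U)$ is the lattice of subspaces of $U\times U$; subspaces $X,Y$ are complementary if $X\oplus Y=U\times U$. *)

theory Defs
  imports "Jordan_Normal_Form.Matrix" "HOL-Library.Product_Plus"
begin

text \<open>
  The ring \<open>R\<close> is a type of sort \<open>{ring, monoid_mult}\<close> rather than of class \<open>ring_1\<close>, because
  \<open>ring_1\<close> includes \<open>0 \<noteq> 1\<close>, and the zero ring is to be allowed.  For the same reason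
  invertibility is spelled out below: the library predicates on matrices require \<open>semiring_1\<close>.
  Not necessarily commutative fields are the class \<open>division_ring\<close>.
\<close>

subsection \<open>The projective line over a ring\<close>

definition GL2 :: "'r::{ring, monoid_mult} mat set" where
  "GL2 = {M \<in> carrier_mat 2 2. \<exists>N \<in> carrier_mat 2 2. M * N = 1\<^sub>m 2 \<and> N * M = 1\<^sub>m 2}"

definition admissible :: "'r::{ring, monoid_mult} \<Rightarrow> 'r \<Rightarrow> bool" where
  "admissible a b \<longleftrightarrow> (\<exists>c d. mat_of_rows_list 2 [[a, b], [c, d]] \<in> GL2)"

text \<open>The cyclic left submodule \<open>R(a,b)\<close> of \<open>R\<^sup>2\<close>; elements of \<open>R\<^sup>2\<close> are pairs.\<close>

definition cyclic_submodule :: "'r::{ring, monoid_mult} \<Rightarrow> 'r \<Rightarrow> ('r \<times> 'r) set" where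
  "cyclic_submodule a b = {(r * a, r * b) | r. True}"

definition projective_line :: "('r::{ring, monoid_mult} \<times> 'r) set set" where
  "projective_line = {cyclic_submodule a b | a b. admissible a b}"

text \<open>Right multiplication of a row vector by a \<open>2 \<times> 2\<close> matrix.\<close>

definition row_times_mat :: "'r::{ring, monoid_mult} \<times> 'r \<Rightarrow> 'r mat \<Rightarrow> 'r \<times> 'r" where
  "row_times_mat v M =
     (fst v * M $$ (0, 0) + snd v * M $$ (1, 0), fst v * M $$ (0, 1) + snd v * M $$ (1, 1))"

definition distant :: "('r::{ring, monoid_mult} \<times> 'r) set \<Rightarrow> ('r \<times> 'r) set \<Rightarrow> bool" where
  "distant p q \<longleftrightarrow> (\<exists>M \<in> GL2.
     (\<lambda>v. row_times_mat v M) ` cyclic_submodule 1 0 = p \<and>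
     (\<lambda>v. row_times_mat v M) ` cyclic_submodule 0 1 = q)"

subsection \<open>Left vector spaces over division rings, and bimodules\<close>

text \<open>The library locales \<open>module\<close> and \<open>vector_space\<close> require commutative scalars.\<close>

locale left_vector_space =
  fixes scale :: "'k::division_ring \<Rightarrow> 'v::ab_group_add \<Rightarrow> 'v"
  assumes scale_right_distrib: "scale k (u + v) = scale k u + scale k v"
    and scale_left_distrib: "scale (k + l) u = scale k u + scale l u"
    and scale_scale: "scale k (scale l u) = scale (k * l) u"
    and scale_one: "scale 1 u = u"

locale bimodule = left_vector_space lact
  for lact :: "'k::division_ring \<Rightarrow> 'u::ab_group_add \<Rightarrow> 'u" +
  fixes ract :: "'u \<Rightarrow> 'r::{ring, monoid_mult} \<Rightarrow> 'u"
  assumes ract_left_distrib: "ract (u + v) a = ract u a + ract v a"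
    and ract_right_distrib: "ract u (a + b) = ract u a + ract u b"
    and ract_ract: "ract (ract u a) b = ract u (a * b)"
    and ract_one: "ract u 1 = u"
    and lact_ract: "lact k (ract u a) = ract (lact k u) a"

definition rho :: "('u \<Rightarrow> 'r \<Rightarrow> 'u) \<Rightarrow> 'r \<Rightarrow> 'u \<Rightarrow> 'u" where
  "rho ract a = (\<lambda>u. ract u a)"

definition faithful :: "('u \<Rightarrow> 'r \<Rightarrow> 'u) \<Rightarrow> bool" where
  "faithful ract \<longleftrightarrow> inj (rho ract)"

subsection \<open>Subspaces, complements and isomorphism\<close>

definition left_subspace :: "('k::division_ring \<Rightarrow> 'v::ab_group_add \<Rightarrow> 'v) \<Rightarrow> 'v set \<Rightarrow> bool" where
  "left_subspace scale X \<longleftrightarrow>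
     0 \<in> X \<and> (\<forall>x \<in> X. \<forall>y \<in> X. x + y \<in> X) \<and> (\<forall>k. \<forall>x \<in> X. scale k x \<in> X)"

definition complementary ::
    "('k::division_ring \<Rightarrow> 'v::ab_group_add \<Rightarrow> 'v) \<Rightarrow> 'v set \<Rightarrow> 'v set \<Rightarrow> bool" where
  "complementary scale X Y \<longleftrightarrow>
     left_subspace scale X \<and> left_subspace scale Y \<and>
     X \<inter> Y = {0} \<and> {x + y | x y. x \<in> X \<and> y \<in> Y} = UNIV"

definition isomorphic_subspaces ::
    "('k::division_ring \<Rightarrow> 'v::ab_group_add \<Rightarrow> 'v) \<Rightarrow> 'v set \<Rightarrow> 'v set \<Rightarrow> bool" where
  "isomorphic_subspaces scale X Y \<longleftrightarrow> (\<exists>f. bij_betw f X Y \<and>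
     (\<forall>x \<in> X. \<forall>y \<in> X. f (x + y) = f x + f y) \<and> (\<forall>k. \<forall>x \<in> X. f (scale k x) = scale k (f x)))"

definition prod_scale :: "('k \<Rightarrow> 'u \<Rightarrow> 'u) \<Rightarrow> 'k \<Rightarrow> 'u \<times> 'u \<Rightarrow> 'u \<times> 'u" where
  "prod_scale lact k w = (lact k (fst w), lact k (snd w))"

lemma (in left_vector_space) left_vector_space_prod_scale:
  "left_vector_space (prod_scale scale)"
  by unfold_locales
    (simp_all add: prod_scale_def scale_right_distrib scale_left_distrib scale_scale scale_one
      prod_eq_iff)

text \<open>The set \<open>\<G>\<close> of all subspaces of \<open>U \<times> U\<close> isomorphic to one of their complements.\<close>

definition subspaces_iso_complement ::
    "('k::division_ring \<Rightarrow> 'u::ab_group_add \<Rightarrow> 'u) \<Rightarrow> ('u \<times> 'u) set set" where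
  "subspaces_iso_complement lact =
     {X. left_subspace (prod_scale lact) X \<and>
         (\<exists>Y. complementary (prod_scale lact) X Y \<and> isomorphic_subspaces (prod_scale lact) X Y)}"

subsection \<open>The mapping \<open>\<Phi>\<close>\<close>

definition pair_image :: "('u \<Rightarrow> 'u) \<Rightarrow> ('u \<Rightarrow> 'u) \<Rightarrow> ('u \<times> 'u) set" where
  "pair_image \<alpha> \<beta> = {(\<alpha> u, \<beta> u) | u. True}"

text \<open>
  The value at a point is given by any admissible representative.  That it does not depend on the
  choice is not built in; for the description operator to be meaningful this has to be proved.
\<close>

definition Phi ::
    "('u \<Rightarrow> 'r::{ring, monoid_mult} \<Rightarrow> 'u) \<Rightarrow> ('r \<times> 'r) set \<Rightarrow> ('u \<times> 'u) set" where
  "Phi ract p = (THE X. \<exists>a b. admissible a b \<and> p = cyclic_submodule a b \<and>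
     X = pair_image (rho ract a) (rho ract b))"

end

theory Submission
  imports Defs
begin

text \<open>
  A pair \<open>(x, y)\<close> of vectors can be multiplied from the right by a \<open>2 \<times> 2\<close> matrix over \<open>R\<close>.  If
  \<open>M\<close> has rows \<open>(a, b)\<close> and \<open>(c, d)\<close> and is invertible, this multiplication is a \<open>K\<close>-linear
  bijection of \<open>U \<times> U\<close> that takes \<open>U \<times> 0\<close> to the image of \<open>R(a, b)\<close> and \<open>0 \<times> U\<close> to the image of
  \<open>R(c, d)\<close>.  As \<open>U \<times> 0\<close> and \<open>0 \<times> U\<close> are isomorphic and complementary, so are these images, which
  settles both that \<open>\<Phi>\<close> maps into \<open>\<G>\<close> and that it takes distant points to complementary
  subspaces (\<open>complementary_pair_images\<close>, \<open>isomorphic_pair_images\<close>).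

  That \<open>\<Phi>\<close> is well defined, indeed monotone, rests on \<open>u \<cdot> (r a) = (u \<cdot> r) \<cdot> a\<close>: a left multiple
  of \<open>(a, b)\<close> has an image contained in that of \<open>(a, b)\<close>.  The converse of this monotonicity is
  what faithfulness gives (\<open>cyclic_submodule_mono_of_faithful\<close>): in the coordinates with respect
  to \<open>M\<close>, membership in the image of \<open>R(a, b)\<close> means that the second coordinate vanishes, and over
  a faithful bimodule a scalar that annihilates every vector is \<open>0\<close>.  If \<open>U\<close> is not faithful, some
  \<open>t \<noteq> 0\<close> annihilates \<open>U\<close>, and \<open>R(1, 0)\<close> and \<open>R(1, t)\<close> are different points with the same image.
\<close>

section \<open>Invertible matrices by their entries\<close>

text \<open>
  The matrices with rows \<open>(a, b)\<close>, \<open>(c, d)\<close> and \<open>(e, f)\<close>, \<open>(g, h)\<close> are inverse to each other.  Both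
  products are needed, since a one-sided inverse over a noncommutative ring need not be two-sided.
\<close>

definition inverse_entries ::
    "'r::{ring, monoid_mult} \<Rightarrow> 'r \<Rightarrow> 'r \<Rightarrow> 'r \<Rightarrow> 'r \<Rightarrow> 'r \<Rightarrow> 'r \<Rightarrow> 'r \<Rightarrow> bool" where
  "inverse_entries a b c d e f g h \<longleftrightarrow>
     a * e + b * g = 1 \<and> a * f + b * h = 0 \<and> c * e + d * g = 0 \<and> c * f + d * h = 1 \<and>
     e * a + f * c = 1 \<and> e * b + f * d = 0 \<and> g * a + h * c = 0 \<and> g * b + h * d = 1"

lemma mat_of_rows_list_2_index [simp]:
  "mat_of_rows_list 2 [[a, b], [c, d]] $$ (0, 0) = a"
  "mat_of_rows_list 2 [[a, b], [c, d]] $$ (0, Suc 0) = b"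
  "mat_of_rows_list 2 [[a, b], [c, d]] $$ (Suc 0, 0) = c"
  "mat_of_rows_list 2 [[a, b], [c, d]] $$ (Suc 0, Suc 0) = d"
  by (simp_all add: mat_of_rows_list_def)

lemma mat_of_rows_list_2_carrier [simp]:
  "mat_of_rows_list 2 [[a, b], [c, d]] \<in> carrier_mat 2 2"
  by (simp add: mat_of_rows_list_def numeral_2_eq_2)

lemma mat_2_eq_mat_of_rows_list:
  assumes "M \<in> carrier_mat 2 2"
  shows "M = mat_of_rows_list 2 [[M $$ (0, 0), M $$ (0, 1)], [M $$ (1, 0), M $$ (1, 1)]]"
  using assms by (intro eq_matI) (auto simp: mat_of_rows_list_def numeral_2_eq_2 less_Suc_eq)

lemma mult_eq_one_mat_2_iff:
  fixes a b c d e f g h :: "'r::{ring, monoid_mult}"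
  shows "mat_of_rows_list 2 [[a, b], [c, d]] * mat_of_rows_list 2 [[e, f], [g, h]] = 1\<^sub>m 2 \<longleftrightarrow>
     a * e + b * g = 1 \<and> a * f + b * h = 0 \<and> c * e + d * g = 0 \<and> c * f + d * h = 1"
  by (auto simp: mat_eq_iff mat_of_rows_list_def scalar_prod_def numeral_2_eq_2 less_Suc_eq)

lemma mat_of_rows_list_in_GL2_iff:
  "mat_of_rows_list 2 [[a, b], [c, d]] \<in> GL2 \<longleftrightarrow> (\<exists>e f g h. inverse_entries a b c d e f g h)"
proof
  assume "mat_of_rows_list 2 [[a, b], [c, d]] \<in> GL2"
  then obtain N where "N \<in> carrier_mat 2 2"
    and "mat_of_rows_list 2 [[a, b], [c, d]] * N = 1\<^sub>m 2"
    and "N * mat_of_rows_list 2 [[a, b], [c, d]] = 1\<^sub>m 2"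
    by (auto simp: GL2_def)
  moreover from \<open>N \<in> carrier_mat 2 2\<close> obtain e f g h
    where "N = mat_of_rows_list 2 [[e, f], [g, h]]"
    using mat_2_eq_mat_of_rows_list by blast
  ultimately have "inverse_entries a b c d e f g h"
    by (simp add: mult_eq_one_mat_2_iff inverse_entries_def)
  then show "\<exists>e f g h. inverse_entries a b c d e f g h"
    by blast
next
  assume "\<exists>e f g h. inverse_entries a b c d e f g h"
  then obtain e f g h where "inverse_entries a b c d e f g h"
    by blast
  then show "mat_of_rows_list 2 [[a, b], [c, d]] \<in> GL2"
    unfolding GL2_def
    by (auto simp: mult_eq_one_mat_2_iff inverse_entries_def
        intro!: bexI[of _ "mat_of_rows_list 2 [[e, f], [g, h]]"])
qed

lemma admissible_iff: "admissible a b \<longleftrightarrow> (\<exists>c d e f g h. inverse_entries a b c d e f g h)"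
  by (simp add: admissible_def mat_of_rows_list_in_GL2_iff)

lemma admissible_rows:
  assumes "inverse_entries a b c d e f g h"
  shows "admissible a b" and "admissible c d"
proof -
  show "admissible a b"
    using assms admissible_iff by blast
  \<comment> \<open>Exchanging the rows of a matrix exchanges the columns of its inverse.\<close>
  have "inverse_entries c d a b f e h g"
    using assms by (simp add: inverse_entries_def add.commute)
  then show "admissible c d"
    using admissible_iff by blast
qed

lemma distantE:
  assumes "distant p q"
  obtains a b c d e f g h where "inverse_entries a b c d e f g h"
    and "p = cyclic_submodule a b" and "q = cyclic_submodule c d"
proof -
  obtain M where M: "M \<in> GL2"
    and p: "(\<lambda>v. row_times_mat v M) ` cyclic_submodule 1 0 = p"
    and q: "(\<lambda>v. row_times_mat v M) ` cyclic_submodule 0 1 = q"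
    using assms by (auto simp: distant_def)
  from M have "M \<in> carrier_mat 2 2"
    by (simp add: GL2_def)
  then obtain a b c d where M_eq: "M = mat_of_rows_list 2 [[a, b], [c, d]]"
    using mat_2_eq_mat_of_rows_list by blast
  have "p = cyclic_submodule a b" and "q = cyclic_submodule c d"
    by (auto simp flip: p q simp: M_eq cyclic_submodule_def row_times_mat_def image_iff)
  moreover obtain e f g h where "inverse_entries a b c d e f g h"
    using M unfolding M_eq mat_of_rows_list_in_GL2_iff by blast
  ultimately show thesis
    using that by blast
qed

lemma generator_in_cyclic_submodule: "(a, b) \<in> cyclic_submodule a b"
  by (auto simp: cyclic_submodule_def intro: exI[of _ 1])

lemma cyclic_submodule_subset_iff:
  "cyclic_submodule a' b' \<subseteq> cyclic_submodule a b \<longleftrightarrow> (\<exists>r. a' = r * a \<and> b' = r * b)"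
proof
  assume "cyclic_submodule a' b' \<subseteq> cyclic_submodule a b"
  then have "(a', b') \<in> cyclic_submodule a b"
    using generator_in_cyclic_submodule by blast
  then show "\<exists>r. a' = r * a \<and> b' = r * b"
    by (auto simp: cyclic_submodule_def)
next
  assume "\<exists>r. a' = r * a \<and> b' = r * b"
  then show "cyclic_submodule a' b' \<subseteq> cyclic_submodule a b"
    by (auto simp: cyclic_submodule_def simp flip: mult.assoc)
qed

section \<open>Images of pairs of scalars\<close>

context bimodule
begin

lemma ract_zero_left [simp]: "ract 0 a = 0"
  using ract_left_distrib[of 0 0 a] by simp

lemma ract_zero_right [simp]: "ract u 0 = 0"
  using ract_right_distrib[of u 0 0] by simp

lemma ract_diff_right: "ract u (a - b) = ract u a - ract u b"
  using ract_right_distrib[of u "a - b" b] by simp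

abbreviation image_of :: "'r \<Rightarrow> 'r \<Rightarrow> ('u \<times> 'u) set" where
  "image_of a b \<equiv> pair_image (rho ract a) (rho ract b)"

lemma image_of_eq: "image_of a b = {(ract u a, ract u b) | u. True}"
  by (simp add: pair_image_def rho_def)

lemma image_of_mono:
  assumes "cyclic_submodule a' b' \<subseteq> cyclic_submodule a b"
  shows "image_of a' b' \<subseteq> image_of a b"
proof -
  obtain r where "a' = r * a" and "b' = r * b"
    using assms by (auto simp: cyclic_submodule_subset_iff)
  then have "(ract u a', ract u b') = (ract (ract u r) a, ract (ract u r) b)" for u
    by (simp add: ract_ract)
  then show ?thesis
    unfolding image_of_eq by blast
qed

lemma Phi_cyclic_submodule:
  assumes "admissible a b"
  shows "Phi ract (cyclic_submodule a b) = image_of a b"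
  unfolding Phi_def
proof (rule the_equality)
  show "\<exists>a' b'. admissible a' b' \<and> cyclic_submodule a b = cyclic_submodule a' b' \<and>
      image_of a b = image_of a' b'"
    using assms by blast
next
  fix X
  assume "\<exists>a' b'. admissible a' b' \<and> cyclic_submodule a b = cyclic_submodule a' b' \<and>
      X = image_of a' b'"
  then obtain a' b' where "cyclic_submodule a b = cyclic_submodule a' b'" and "X = image_of a' b'"
    by blast
  then show "X = image_of a b"
    by (simp add: image_of_mono subset_antisym)
qed

lemma left_subspace_image_of: "left_subspace (prod_scale lact) (image_of a b)"
proof -
  have "0 = (ract 0 a, ract 0 b)"
    by (simp add: zero_prod_def)
  moreover have "(ract u a, ract u b) + (ract v a, ract v b) = (ract (u + v) a, ract (u + v) b)"
    for u v
    by (simp add: ract_left_distrib)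
  moreover have "prod_scale lact k (ract u a, ract u b) = (ract (lact k u) a, ract (lact k u) b)"
    for k u
    by (simp add: prod_scale_def lact_ract)
  ultimately show ?thesis
    unfolding left_subspace_def image_of_eq by blast
qed

section \<open>Coordinates with respect to an invertible matrix\<close>

text \<open>
  By the bimodule laws, multiplication of vector pairs by matrices is compatible with the matrix
  product, so the inverse matrix undoes \<open>(u, v) \<mapsto> u (a, b) + v (c, d)\<close>.  Thus every vector pair has
  unique coordinates \<open>u\<close> and \<open>v\<close> with respect to the rows \<open>(a, b)\<close> and \<open>(c, d)\<close>.
\<close>

lemma coordinates_of_combination:
  assumes "inverse_entries a b c d e f g h"
  shows "ract (ract u a + ract v c) e + ract (ract u b + ract v d) g = u"
    and "ract (ract u a + ract v c) f + ract (ract u b + ract v d) h = v"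
proof -
  have "ract (ract u a + ract v c) e + ract (ract u b + ract v d) g =
      ract u (a * e + b * g) + ract v (c * e + d * g)"
    by (simp add: ract_left_distrib ract_right_distrib ract_ract algebra_simps)
  then show "ract (ract u a + ract v c) e + ract (ract u b + ract v d) g = u"
    using assms by (simp add: inverse_entries_def ract_one)
  have "ract (ract u a + ract v c) f + ract (ract u b + ract v d) h =
      ract u (a * f + b * h) + ract v (c * f + d * h)"
    by (simp add: ract_left_distrib ract_right_distrib ract_ract algebra_simps)
  then show "ract (ract u a + ract v c) f + ract (ract u b + ract v d) h = v"
    using assms by (simp add: inverse_entries_def ract_one)
qed

lemma coordinates_of_multiple:
  assumes "inverse_entries a b c d e f g h"
  shows "ract (ract u a) e + ract (ract u b) g = u"
    and "ract (ract u a) f + ract (ract u b) h = 0"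
  using coordinates_of_combination[OF assms, of u 0] by simp_all

lemma combination_of_coordinates:
  assumes "inverse_entries a b c d e f g h"
  shows "ract (ract x e + ract y g) a + ract (ract x f + ract y h) c = x"
    and "ract (ract x e + ract y g) b + ract (ract x f + ract y h) d = y"
proof -
  have "inverse_entries e f g h a b c d"
    using assms by (simp add: inverse_entries_def)
  from coordinates_of_combination[OF this, of x y]
  show "ract (ract x e + ract y g) a + ract (ract x f + ract y h) c = x"
    and "ract (ract x e + ract y g) b + ract (ract x f + ract y h) d = y"
    by simp_all
qed

lemma complementary_pair_images:
  assumes inv: "inverse_entries a b c d e f g h"
  shows "complementary (prod_scale lact) (image_of a b) (image_of c d)"
  unfolding complementary_def
proof (intro conjI left_subspace_image_of)
  have "w = 0" if "w \<in> image_of a b" and "w \<in> image_of c d" for w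
  proof -
    from that obtain u v where w: "w = (ract u a, ract u b)" "w = (ract v c, ract v d)"
      unfolding image_of_eq by blast
    have "u = ract (fst w) e + ract (snd w) g"
      using coordinates_of_multiple(1)[OF inv] by (simp add: w(1))
    also have "\<dots> = 0"
      using coordinates_of_combination(1)[OF inv, of 0 v] by (simp add: w(2))
    finally show "w = 0"
      by (simp add: w(1) zero_prod_def)
  qed
  moreover have "0 \<in> image_of a b" and "0 \<in> image_of c d"
    using left_subspace_image_of by (simp_all add: left_subspace_def)
  ultimately show "image_of a b \<inter> image_of c d = {0}"
    by blast
next
  have "w \<in> {x + y | x y. x \<in> image_of a b \<and> y \<in> image_of c d}" for w
  proof -
    define u v where "u = ract (fst w) e + ract (snd w) g" and "v = ract (fst w) f + ract (snd w) h"
    have "w = (ract u a, ract u b) + (ract v c, ract v d)"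
      by (simp add: u_def v_def prod_eq_iff combination_of_coordinates[OF inv])
    then show ?thesis
      unfolding image_of_eq by blast
  qed
  then show "{x + y | x y. x \<in> image_of a b \<and> y \<in> image_of c d} = UNIV"
    by blast
qed

text \<open>
  The isomorphism is \<open>u (a, b) \<mapsto> u (c, d)\<close>.  It is well defined and linear because \<open>u\<close> can be read
  off from \<open>u (a, b)\<close> by multiplication with the first column of the inverse matrix.
\<close>

lemma isomorphic_pair_images:
  assumes inv: "inverse_entries a b c d e f g h"
  shows "isomorphic_subspaces (prod_scale lact) (image_of a b) (image_of c d)"
proof -
  define coord where "coord w = ract (fst w) e + ract (snd w) g" for w
  define \<phi> where "\<phi> w = (ract (coord w) c, ract (coord w) d)" for w
  have \<phi>_multiple: "\<phi> (ract u a, ract u b) = (ract u c, ract u d)" for u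
    by (simp add: \<phi>_def coord_def coordinates_of_multiple[OF inv])
  have coord_add: "coord (w + w') = coord w + coord w'" for w w'
    by (simp add: coord_def ract_left_distrib algebra_simps)
  have coord_scale: "coord (prod_scale lact k w) = lact k (coord w)" for k w
    by (simp add: coord_def prod_scale_def scale_right_distrib lact_ract)
  have "bij_betw \<phi> (image_of a b) (image_of c d)"
  proof (rule bij_betw_imageI)
    have "u = v" if "(ract u c, ract u d) = (ract v c, ract v d)" for u v
      using that coordinates_of_combination(2)[OF inv, of 0 u]
        coordinates_of_combination(2)[OF inv, of 0 v] by simp
    then have "(ract u a, ract u b) = (ract v a, ract v b)"
      if "\<phi> (ract u a, ract u b) = \<phi> (ract v a, ract v b)" for u v
      using that \<phi>_multiple by metis
    then show "inj_on \<phi> (image_of a b)"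
      unfolding inj_on_def image_of_eq by blast
    have "\<phi> ` range (\<lambda>u. (ract u a, ract u b)) = range (\<lambda>u. (ract u c, ract u d))"
      by (simp only: image_image \<phi>_multiple)
    then show "\<phi> ` image_of a b = image_of c d"
      by (simp add: image_of_eq full_SetCompr_eq)
  qed
  moreover have "\<phi> (w + w') = \<phi> w + \<phi> w'" for w w'
    by (simp add: \<phi>_def coord_add ract_left_distrib)
  moreover have "\<phi> (prod_scale lact k w) = prod_scale lact k (\<phi> w)" for k w
    unfolding \<phi>_def coord_scale by (simp add: prod_scale_def lact_ract)
  ultimately show ?thesis
    unfolding isomorphic_subspaces_def by blast
qed

section \<open>Faithfulness and injectivity\<close>

text \<open>
  Write \<open>(a', b') = r (a, b) + s (c, d)\<close>.  For every \<open>u\<close> the vector \<open>u (a', b')\<close> has second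
  coordinate \<open>u s\<close>, which is \<open>0\<close> because the vector is a multiple of \<open>(a, b)\<close>.  Hence \<open>s\<close>
  annihilates \<open>U\<close>, so \<open>s = 0\<close>.
\<close>

lemma cyclic_submodule_mono_of_faithful:
  assumes "faithful ract" and "admissible a b" and sub: "image_of a' b' \<subseteq> image_of a b"
  shows "cyclic_submodule a' b' \<subseteq> cyclic_submodule a b"
proof -
  obtain c d e f g h where inv: "inverse_entries a b c d e f g h"
    using \<open>admissible a b\<close> admissible_iff by blast
  define r s where "r = a' * e + b' * g" and "s = a' * f + b' * h"
  have "ract u s = ract u 0" for u
  proof -
    obtain v where "ract u a' = ract v a" and "ract u b' = ract v b"
      using sub by (auto simp: image_of_eq)
    then have "ract u s = ract (ract v a) f + ract (ract v b) h"
      by (simp add: s_def ract_right_distrib flip: ract_ract)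
    then show ?thesis
      by (simp add: coordinates_of_multiple[OF inv])
  qed
  then have "s = 0"
    using \<open>faithful ract\<close> by (auto simp: faithful_def rho_def inj_def)
  have "a' * (e * a + f * c) + b' * (g * a + h * c) = r * a + s * c"
    and "a' * (e * b + f * d) + b' * (g * b + h * d) = r * b + s * d"
    by (simp_all add: r_def s_def algebra_simps)
  then have "a' = r * a" and "b' = r * b"
    using inv \<open>s = 0\<close> by (simp_all add: inverse_entries_def)
  then show ?thesis
    by (auto simp: cyclic_submodule_subset_iff)
qed

lemma Phi_inj_of_faithful:
  assumes "faithful ract"
  shows "inj_on (Phi ract) projective_line"
proof (rule inj_onI)
  fix p q :: "('r \<times> 'r) set"
  assume "p \<in> projective_line" and "q \<in> projective_line"
  then obtain a b a' b' where ab: "admissible a b" "p = cyclic_submodule a b"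
    and a'b': "admissible a' b'" "q = cyclic_submodule a' b'"
    by (auto simp: projective_line_def)
  assume "Phi ract p = Phi ract q"
  then have "image_of a b = image_of a' b'"
    using ab a'b' by (simp add: Phi_cyclic_submodule)
  then show "p = q"
    using cyclic_submodule_mono_of_faithful[OF assms] ab a'b' by (simp add: subset_antisym)
qed

text \<open>
  If \<open>a\<close> and \<open>b\<close> act in the same way, then \<open>t = a - b\<close> acts as \<open>0\<close>, so the points \<open>R(1, 0)\<close> and
  \<open>R(1, t)\<close> both have the image \<open>U \<times> 0\<close>; and they coincide only if \<open>t = 0\<close>.
\<close>

lemma faithful_of_Phi_inj:
  assumes inj: "inj_on (Phi ract) projective_line"
  shows "faithful ract"
  unfolding faithful_def
proof (rule injI)
  fix a b :: 'r
  assume "rho ract a = rho ract b"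
  then have "ract u a = ract u b" for u
    by (metis rho_def)
  define t where "t = a - b"
  have t: "ract u t = 0" for u
    by (simp add: t_def ract_diff_right \<open>ract u a = ract u b\<close>)
  have adm: "admissible 1 s" for s :: 'r
    by (rule admissible_rows(1)[of 1 s 0 1 1 "- s" 0 1]) (simp add: inverse_entries_def)
  have "image_of 1 t = image_of 1 0"
    by (simp add: image_of_eq t)
  then have "Phi ract (cyclic_submodule 1 t) = Phi ract (cyclic_submodule 1 0)"
    by (simp add: Phi_cyclic_submodule adm)
  then have "cyclic_submodule 1 t = cyclic_submodule 1 0"
    by (rule inj_onD[OF inj]) (use adm in \<open>auto simp: projective_line_def\<close>)
  then have "\<exists>r. 1 = r * 1 \<and> t = r * 0"
    using cyclic_submodule_subset_iff[of 1 t 1 0] by simp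
  then show "a = b"
    by (simp add: t_def)
qed

end

theorem theorem4p2:
  fixes lact :: "'k::division_ring \<Rightarrow> 'u::ab_group_add \<Rightarrow> 'u"
    and ract :: "'u \<Rightarrow> 'r::{ring, monoid_mult} \<Rightarrow> 'u"
  assumes "bimodule lact ract"
  shows "(\<forall>a b. admissible a b \<longrightarrow>
             Phi ract (cyclic_submodule a b) = pair_image (rho ract a) (rho ract b)) \<and>
         Phi ract ` projective_line \<subseteq> subspaces_iso_complement lact \<and>
         (\<forall>p \<in> projective_line. \<forall>q \<in> projective_line. distant p q \<longrightarrow>
             complementary (prod_scale lact) (Phi ract p) (Phi ract q)) \<and>
         (faithful ract \<longleftrightarrow> inj_on (Phi ract) projective_line)"
proof (intro conjI)
  interpret bimodule lact ract
    by (rule assms)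
  show "\<forall>a b. admissible a b \<longrightarrow> Phi ract (cyclic_submodule a b) = image_of a b"
    using Phi_cyclic_submodule by blast
  show "Phi ract ` projective_line \<subseteq> subspaces_iso_complement lact"
  proof (clarsimp simp: projective_line_def)
    fix a b :: 'r
    assume ab: "admissible a b"
    then obtain c d e f g h where "inverse_entries a b c d e f g h"
      using admissible_iff by blast
    then show "Phi ract (cyclic_submodule a b) \<in> subspaces_iso_complement lact"
      unfolding Phi_cyclic_submodule[OF ab] subspaces_iso_complement_def
      using left_subspace_image_of complementary_pair_images isomorphic_pair_images by blast
  qed
  show "\<forall>p \<in> projective_line. \<forall>q \<in> projective_line. distant p q \<longrightarrow>
      complementary (prod_scale lact) (Phi ract p) (Phi ract q)"
    by (auto elim!: distantE simp: Phi_cyclic_submodule admissible_rows complementary_pair_images)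
  show "faithful ract \<longleftrightarrow> inj_on (Phi ract) projective_line"
    using Phi_inj_of_faithful faithful_of_Phi_inj by blast
qed

end
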